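(* Let $X\subset\mathbb{R}^D$ and $f:X\to X$ be as in the context (an injective, non-singular, piecewise $C^1$-diffeomorphism with singular set $\Delta$), and let $\varepsilon\in(0,1)$. Then, for any $z\in X$ defining the observable $Y_0(\cdot)=-\log d(\cdot,z)$ and any $0<\tau<\infty$, there exists a sequence $(u_n)_{n\in\mathbb{N}}$ such that $$\lim_{n\to\infty}n\,\mathbb{P}(Y_0>u_n)=\tau.$$
   Context: The map. $X$ is a compact subset of $\mathbb{R}^D$ which is the closure of its interior, $X=\overline{\mathrm{int}(X)}$, equipped with a metric $d$ and with the normalized Lebesgue measure $m$. $\{X_i\}_{i=1}^N$ is a collection of $N$ disjoint open subsets of $X$ such that $X=\bigcup_{i=1}^N\overline{X_i}$ and $m(\Delta)=0$, where $\Delta:=X\setminus\bigcup_{i=1}^N X_i$ is the singular set. The map $f:X\to X$ is non-singular, injective, and such that $f|_{X\setminus\Delta}$ is a $C^1$-diffeomorphism (onto its image). Randomly applied stochastic perturbation. Let $\Omega_\varepsilon=\{0,1\}\times X$ and let $\theta_\varepsilon$ be the product of the Bernoulli measure with weights $(\varepsilon,1-\varepsilon)$ on $\{0,1\}$ (so $0$ has probability $\varepsilon$) and the uniform measure on $X$. For $\omega=(\eta,\xi)\in\Omega_\varepsilon$ put $f_\omega(x)=\eta f(x)+(1-\eta)\xi$. Let $\mu_\varepsilon$ be the absolutely continuous (with respect to $m$) stationary probability measure, i.e. $\mu_\varepsilon(A)=\int_X\int_{\Omega_\varepsilon}\mathbf 1_A(f_\omega(x))\,d\theta_\varepsilon(\omega)\,d\mu_\varepsilon(x)$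 for all measurable $A\subset X$; its density is $h_\varepsilon=\varepsilon\sum_{k=0}^\infty(1-\varepsilon)^kP^k\mathbf 1$, with $P$ the transfer operator of $f$ on $L^1(m)$. Put $\mathbb{P}=\mu_\varepsilon\times\theta_\varepsilon^{\mathbb{N}}$ on $X\times\Omega_\varepsilon^{\mathbb{N}}$; $Y_0$ depends only on the initial point $x\in X$, so $\mathbb{P}(Y_0>u)=\mu_\varepsilon(\{x: -\log d(x,z)>u\})$.
   Formalization: The metric d is additionally assumed to induce the usual topology of X and to have spheres of Lebesgue measure zero (true for the Euclidean distance); for an arbitrary metric, e.g. the discrete one, the claim is false. *)

theory Defs
  imports "HOL-Probability.Probability"
begin

text \<open>The completed \<sigma>-algebra is used: an arbitrary \<open>f\<close> on the null set \<open>\<Delta>\<close>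
  need not be Borel measurable there.\<close>

definition normalized_lebesgue :: "'a::euclidean_space set \<Rightarrow> 'a measure" where
  "normalized_lebesgue X = restrict_space (uniform_measure lebesgue X) X"

lemma space_normalized_lebesgue [simp]: "space (normalized_lebesgue X) = X"
  by (simp add: normalized_lebesgue_def space_restrict_space)

definition nonsingular_map :: "'a measure \<Rightarrow> ('a \<Rightarrow> 'a) \<Rightarrow> bool" where
  "nonsingular_map M f \<longleftrightarrow>
     f \<in> measurable M M \<and> (\<forall>A \<in> null_sets M. f -` A \<inter> space M \<in> null_sets M)"

text \<open>Derivatives are taken within \<open>S\<close>, since a set that is open relative to \<open>X\<close> may
  contain boundary points of \<open>X\<close>. On an open set this is ordinary continuous differentiability.\<close>

definition C1_on :: "'a::real_normed_vector set \<Rightarrow> ('a \<Rightarrow> 'b::real_normed_vector) \<Rightarrow> bool" where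
  "C1_on S f \<longleftrightarrow>
     (\<exists>f' :: 'a \<Rightarrow> 'a \<Rightarrow>\<^sub>L 'b.
        (\<forall>x\<in>S. (f has_derivative blinfun_apply (f' x)) (at x within S)) \<and> continuous_on S f')"

definition C1_diffeo_onto_image ::
    "'a::real_normed_vector set \<Rightarrow> ('a \<Rightarrow> 'b::real_normed_vector) \<Rightarrow> bool" where
  "C1_diffeo_onto_image S f \<longleftrightarrow> C1_on S f \<and> inj_on f S \<and> C1_on (f ` S) (the_inv_into S f)"

text \<open>A noise value is \<open>\<omega> = (\<eta>, \<xi>)\<close>, where \<open>\<eta>\<close> is a Boolean standing for \<open>0\<close> (\<open>False\<close>) or
  \<open>1\<close> (\<open>True\<close>); \<open>bernoulli_pmf (1 - \<epsilon>)\<close> gives \<open>False\<close> the weight \<open>\<epsilon>\<close>.\<close>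

definition noise :: "'a::euclidean_space set \<Rightarrow> real \<Rightarrow> (bool \<times> 'a) measure" where
  "noise X \<epsilon> = measure_pmf (bernoulli_pmf (1 - \<epsilon>)) \<Otimes>\<^sub>M normalized_lebesgue X"

definition perturbed_map :: "('a \<Rightarrow> 'a) \<Rightarrow> bool \<times> 'a \<Rightarrow> 'a \<Rightarrow> 'a::real_vector" where
  "perturbed_map f \<omega> x =
     of_bool (fst \<omega>) *\<^sub>R f x + (1 - of_bool (fst \<omega>)) *\<^sub>R snd \<omega>"

definition ac_stationary_prob ::
    "'a::euclidean_space set \<Rightarrow> ('a \<Rightarrow> 'a) \<Rightarrow> real \<Rightarrow> 'a measure \<Rightarrow> bool" where
  "ac_stationary_prob X f \<epsilon> \<mu> \<longleftrightarrow>
     prob_space \<mu> \<and>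
     sets \<mu> = sets (normalized_lebesgue X) \<and>
     absolutely_continuous (normalized_lebesgue X) \<mu> \<and>
     (\<forall>A \<in> sets \<mu>.
        emeasure \<mu> A =
          (\<integral>\<^sup>+ x. (\<integral>\<^sup>+ \<omega>. indicator A (perturbed_map f \<omega> x) \<partial>noise X \<epsilon>) \<partial>\<mu>))"

definition random_orbit_measure ::
    "'a::euclidean_space set \<Rightarrow> real \<Rightarrow> 'a measure \<Rightarrow> ('a \<times> (nat \<Rightarrow> bool \<times> 'a)) measure" where
  "random_orbit_measure X \<epsilon> \<mu> = \<mu> \<Otimes>\<^sub>M (\<Pi>\<^sub>M i\<in>UNIV. noise X \<epsilon>)"

text \<open>The value at \<open>x = z\<close> is \<open>\<infinity>\<close>; the library's convention \<open>ln 0 = 0\<close> would give \<open>0\<close>.\<close>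

definition obs_Y0 :: "('a \<Rightarrow> 'a \<Rightarrow> real) \<Rightarrow> 'a \<Rightarrow> 'a \<times> 'b \<Rightarrow> ereal" where
  "obs_Y0 d z p = (if d (fst p) z = 0 then \<infinity> else ereal (- ln (d (fst p) z)))"

text \<open>A metric on \<open>X\<close> is assumed below to induce the topology of \<open>X\<close> and to have spheres of
  measure zero. Without this the law of \<open>Y\<^sub>0\<close> can have atoms and the claim can fail, as for the
  discrete metric. The Euclidean distance satisfies these conditions:\<close>

definition null_spheres :: "'a::euclidean_space set \<Rightarrow> ('a \<Rightarrow> 'a \<Rightarrow> real) \<Rightarrow> bool" where
  "null_spheres X d \<longleftrightarrow>
     (\<forall>z\<in>X. \<forall>r>0. {x \<in> X. d x z = r} \<in> null_sets (normalized_lebesgue X))"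

lemma euclidean_dist_conditions:
  fixes X :: "'a::euclidean_space set"
  assumes "compact X"
  shows "Metric_space X dist" "Metric_space.mtopology X dist = top_of_set X" "null_spheres X dist"
proof -
  interpret Submetric UNIV dist X
    by unfold_locales (auto simp: Met_TC.commute)
  show "Metric_space X dist"
    by (rule sub.Metric_space_axioms)
  show "Metric_space.mtopology X dist = top_of_set X"
    using mtopology_submetric by simp
  have X: "X \<in> sets lebesgue"
    using assms by (simp add: compact_imp_closed borel_closed)
  have "{x \<in> X. dist x z = r} \<in> null_sets (normalized_lebesgue X)" for z and r :: real
  proof -
    have "{x \<in> X. dist x z = r} = X \<inter> sphere z r"
      by (auto simp: dist_commute)
    moreover have "X \<inter> sphere z r \<in> null_sets lebesgue"
      using negligible_sphere[of z r] negligible_subset[of "sphere z r" "X \<inter> sphere z r"]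
      by (simp add: negligible_iff_null_sets)
    ultimately show ?thesis
      using X by (auto simp: normalized_lebesgue_def null_sets_restrict_space null_sets_def
          emeasure_restrict_space sets_restrict_space_iff Int_absorb1)
  qed
  then show "null_spheres X dist"
    by (simp add: null_spheres_def)
qed

end

theory Submission
  imports Defs
begin

text \<open>The law of the distance to \<open>z\<close> under \<open>\<mu>\<close> has no atoms: spheres of positive radius are null
  by assumption, the sphere of radius \<open>0\<close> is the point \<open>z\<close>, and absolute continuity transports both
  facts from Lebesgue measure to \<open>\<mu>\<close>. Its distribution function is therefore continuous and, by the
  intermediate value theorem, takes the value \<open>\<tau> / n\<close> exactly as soon as \<open>n > \<tau>\<close>, at some radius
  \<open>r\<^sub>n > 0\<close>. With \<open>u\<^sub>n = - ln r\<^sub>n\<close> the event \<open>Y\<^sub>0 > u\<^sub>n\<close> says that the initial point lies in the open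
  \<open>d\<close>-ball of radius \<open>r\<^sub>n\<close> about \<open>z\<close>, so the sequence in question is eventually constant, equal
  to \<open>\<tau>\<close>.\<close>

text \<open>Without atoms the distribution function is continuous, and its limits at \<open>-\<infinity>\<close> and \<open>\<infinity>\<close> are
  \<open>0\<close> and \<open>1\<close>, so it attains every level strictly between them.\<close>

lemma (in real_distribution) atomless_quantile:
  assumes atomless: "\<And>x. measure M {x} = 0" and p: "0 < p" "p < 1"
  obtains r where "cdf M r = p"
proof -
  have "eventually (\<lambda>x. cdf M x < p) at_bot"
    using order_tendstoD(2)[OF cdf_lim_at_bot p(1)] .
  then obtain a where a: "\<And>x. x \<le> a \<Longrightarrow> cdf M x < p"
    by (auto simp: eventually_at_bot_linorder)
  have "eventually (\<lambda>x. p < cdf M x) at_top"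
    using order_tendstoD(1)[OF cdf_lim_at_top_prob p(2)] .
  then obtain b where b: "\<And>x. b \<le> x \<Longrightarrow> p < cdf M x"
    by (auto simp: eventually_at_top_linorder)
  have "\<exists>r. a \<le> r \<and> r \<le> max a b \<and> cdf M r = p"
    using a[of a] b[of "max a b"] isCont_cdf atomless by (intro IVT) auto
  with that show thesis by blast
qed

lemma sets_normalized_lebesgue:
  assumes "X \<in> sets lebesgue"
  shows "A \<in> sets (normalized_lebesgue X) \<longleftrightarrow> A \<subseteq> X \<and> A \<in> sets lebesgue"
  using assms by (auto simp: normalized_lebesgue_def sets_restrict_space_iff)

text \<open>A nonempty set that is the closure of its interior has positive volume, and compactness makes
  the volume finite, so the normalization is by a genuine positive number.\<close>

lemma prob_space_normalized_lebesgue: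
  fixes X :: "'a::euclidean_space set"
  assumes "compact X" and "X = closure (interior X)" and "X \<noteq> {}"
  shows "prob_space (normalized_lebesgue X)"
proof -
  have X: "X \<in> sets lebesgue"
    using assms(1) by (simp add: compact_imp_closed borel_closed)
  have "interior X \<noteq> {}"
    using assms(2,3) by auto
  then have "\<not> negligible X"
    using negligible_subset[OF _ interior_subset] open_not_negligible[OF open_interior] by blast
  then have pos: "emeasure lebesgue X \<noteq> 0"
    using X by (simp add: negligible_iff_emeasure0)
  have fin: "emeasure lebesgue X \<noteq> \<infinity>"
    using emeasure_compact_finite[OF assms(1)] X assms(1)
    by (simp add: compact_imp_closed borel_closed)
  have "emeasure (normalized_lebesgue X) X = emeasure (uniform_measure lebesgue X) X"
    using X by (simp add: normalized_lebesgue_def emeasure_restrict_space)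
  also have "\<dots> = 1"
    using X pos fin by (simp add: ennreal_divide_self less_top)
  finally show ?thesis
    by (intro prob_spaceI) simp
qed

lemma singleton_null_normalized_lebesgue:
  assumes X: "X \<in> sets lebesgue" and "z \<in> X"
  shows "{z} \<in> null_sets (normalized_lebesgue X)"
proof (rule null_setsI)
  have z: "{z} \<in> sets lebesgue" "emeasure lebesgue {z} = 0"
    by simp_all
  show "{z} \<in> sets (normalized_lebesgue X)"
    using assms z by (simp add: sets_normalized_lebesgue)
  show "emeasure (normalized_lebesgue X) {z} = 0"
    using assms z
    by (simp add: normalized_lebesgue_def emeasure_restrict_space Int_absorb1)
qed

lemma prob_space_noise:
  assumes "prob_space (normalized_lebesgue X)"
  shows "prob_space (noise X \<epsilon>)"
proof -
  interpret L: prob_space "normalized_lebesgue X" by fact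
  interpret pair_prob_space "measure_pmf (bernoulli_pmf (1 - \<epsilon>))" "normalized_lebesgue X"
    by unfold_locales
  show ?thesis
    unfolding noise_def by unfold_locales
qed

text \<open>The noise has total mass \<open>1\<close>, so events about the initial point keep their \<open>\<mu>\<close>-probability
  on the space of random orbits.\<close>

lemma measure_random_orbit_initial_event:
  assumes "prob_space (noise X \<epsilon>)" and "prob_space \<mu>" and "B \<in> sets \<mu>"
  shows "measure (random_orbit_measure X \<epsilon> \<mu>)
           {p \<in> space (random_orbit_measure X \<epsilon> \<mu>). fst p \<in> B} = measure \<mu> B"
proof -
  interpret P: prob_space "\<Pi>\<^sub>M i\<in>(UNIV::nat set). noise X \<epsilon>"
    using assms(1) by (rule prob_space_PiM)
  interpret M: prob_space \<mu> by fact
  have "{p \<in> space (random_orbit_measure X \<epsilon> \<mu>). fst p \<in> B}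
      = B \<times> space (\<Pi>\<^sub>M i\<in>(UNIV::nat set). noise X \<epsilon>)"
    using sets.sets_into_space[OF assms(3)]
    by (auto simp: random_orbit_measure_def space_pair_measure)
  then show ?thesis
    using assms(3) P.emeasure_space_1
    by (simp add: random_orbit_measure_def measure_def P.emeasure_pair_measure_Times)
qed

theorem proposition4p1:
  fixes X :: "'a::euclidean_space set"
    and d :: "'a \<Rightarrow> 'a \<Rightarrow> real"
    and N :: nat
    and Xs :: "nat \<Rightarrow> 'a set"
    and \<Delta> :: "'a set"
    and f :: "'a \<Rightarrow> 'a"
    and \<epsilon> \<tau> :: real
    and \<mu> :: "'a measure"
    and z :: 'a
  assumes "compact X" and "X = closure (interior X)"
    and "Metric_space X d" and "Metric_space.mtopology X d = top_of_set X"
    and "null_spheres X d"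
    and "\<And>i. i \<in> {1..N} \<Longrightarrow> openin (top_of_set X) (Xs i)"
    and "disjoint_family_on Xs {1..N}"
    and "X = (\<Union>i\<in>{1..N}. closure (Xs i))"
    and "\<Delta> = X - (\<Union>i\<in>{1..N}. Xs i)"
    and "\<Delta> \<in> null_sets (normalized_lebesgue X)"
    and "f ` X \<subseteq> X" and "inj_on f X"
    and "nonsingular_map (normalized_lebesgue X) f"
    and "C1_diffeo_onto_image (X - \<Delta>) f"
    and "0 < \<epsilon>" and "\<epsilon> < 1"
    and "ac_stationary_prob X f \<epsilon> \<mu>"
    and "z \<in> X" and "0 < \<tau>"
  shows "\<exists>u :: nat \<Rightarrow> real.
    (\<lambda>n. real n * measure (random_orbit_measure X \<epsilon> \<mu>)
            {p \<in> space (random_orbit_measure X \<epsilon> \<mu>). obs_Y0 d z p > ereal (u n)})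
      \<longlonglongrightarrow> \<tau>"
proof -
  interpret M: Metric_space X d by fact
  have X: "X \<in> sets lebesgue"
    using assms(1) by (simp add: compact_imp_closed borel_closed)
  have sets_mu: "sets \<mu> = sets (normalized_lebesgue X)"
    and ac: "absolutely_continuous (normalized_lebesgue X) \<mu>"
    and prob: "prob_space \<mu>"
    using \<open>ac_stationary_prob X f \<epsilon> \<mu>\<close> by (auto simp: ac_stationary_prob_def)
  interpret mu: prob_space \<mu> by fact
  have space_mu: "space \<mu> = X"
    using sets_eq_imp_space_eq[OF sets_mu] by simp
  have noise: "prob_space (noise X \<epsilon>)"
    using prob_space_normalized_lebesgue[OF assms(1,2)] \<open>z \<in> X\<close> by (auto intro: prob_space_noise)

  have ball: "{x \<in> X. d x z < r} \<in> sets \<mu>" for r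
  proof -
    have "{x \<in> X. d x z < r} = M.mball z r"
      using \<open>z \<in> X\<close> by (auto simp: M.commute)
    then have "openin (top_of_set X) {x \<in> X. d x z < r}"
      using M.openin_mball[of z r] by (simp add: assms(4))
    then obtain T where "open T" "{x \<in> X. d x z < r} = X \<inter> T"
      by (auto simp: openin_open)
    moreover from \<open>open T\<close> have "T \<in> sets lebesgue"
      by (simp add: borel_open)
    ultimately show ?thesis
      using X by (auto simp: sets_mu sets_normalized_lebesgue)
  qed
  then have dist_meas [measurable]: "(\<lambda>x. d x z) \<in> borel_measurable \<mu>"
    by (simp add: borel_measurable_iff_less space_mu)
  have sphere_null: "{x \<in> X. d x z = r} \<in> null_sets \<mu>" for r
  proof -
    consider "r < 0" | "r = 0" | "r > 0" by linarith
    then have "{x \<in> X. d x z = r} \<in> null_sets (normalized_lebesgue X)"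
    proof cases
      case 1
      then have empty: "{x \<in> X. d x z = r} = {}"
        using M.nonneg by (auto simp: not_less[symmetric])
      show ?thesis unfolding empty by simp
    next
      case 2
      then have "{x \<in> X. d x z = r} = {z}"
        using \<open>z \<in> X\<close> by auto
      then show ?thesis
        using singleton_null_normalized_lebesgue[OF X \<open>z \<in> X\<close>] by simp
    next
      case 3
      then show ?thesis
        using \<open>null_spheres X d\<close> \<open>z \<in> X\<close> by (simp add: null_spheres_def)
    qed
    then show ?thesis
      using ac by (auto simp: absolutely_continuous_def)
  qed

  define D where "D = distr \<mu> borel (\<lambda>x. d x z)"
  interpret D: real_distribution D
    unfolding D_def by (rule mu.real_distribution_distr) simp
  have atomless: "measure D {r} = 0" for r
  proof -
    have "measure D {r} = measure \<mu> {x \<in> X. d x z = r}"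
      by (auto simp: D_def measure_distr space_mu intro!: arg_cong[where f="measure \<mu>"])
    with sphere_null[of r] show ?thesis
      by (simp add: measure_def null_setsD1)
  qed
  have cdf_ball: "cdf D r = measure \<mu> {x \<in> X. d x z < r}" for r
  proof -
    have "cdf D r = measure \<mu> ({x \<in> X. d x z < r} \<union> {x \<in> X. d x z = r})"
      by (auto simp: cdf_def D_def measure_distr space_mu intro!: arg_cong[where f="measure \<mu>"])
    then show ?thesis
      using measure_Un_null_set[OF ball sphere_null] by simp
  qed

  have "\<exists>r. 0 < r \<and> cdf D r = \<tau> / real n" if n: "\<tau> < real n" for n
  proof -
    obtain r where r: "cdf D r = \<tau> / real n"
      using D.atomless_quantile[OF atomless, of "\<tau> / real n"] n \<open>0 < \<tau>\<close> by auto
    \<comment> \<open>A ball of radius at most \<open>0\<close> is empty, whereas \<open>\<tau> / n > 0\<close>.\<close>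
    have "0 < r"
    proof (rule ccontr)
      assume "\<not> 0 < r"
      then have empty: "{x \<in> X. d x z < r} = {}"
        using M.nonneg by (auto simp: not_less intro: order_trans)
      have "cdf D r = 0"
        unfolding cdf_ball empty by simp
      with r n \<open>0 < \<tau>\<close> show False by simp
    qed
    with r show ?thesis by blast
  qed
  then obtain \<rho> where \<rho>: "\<And>n. \<tau> < real n \<Longrightarrow> 0 < \<rho> n \<and> cdf D (\<rho> n) = \<tau> / real n"
    by metis
  define u where "u n = - ln (\<rho> n)" for n :: nat

  have "real n * measure (random_orbit_measure X \<epsilon> \<mu>)
      {p \<in> space (random_orbit_measure X \<epsilon> \<mu>). obs_Y0 d z p > ereal (u n)} = \<tau>"
    if n: "\<tau> < real n" for n
  proof -
    have "obs_Y0 d z p > ereal (u n) \<longleftrightarrow> d (fst p) z < \<rho> n" for p :: "'a \<times> (nat \<Rightarrow> bool \<times> 'a)"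
    proof (cases "d (fst p) z = 0")
      case False
      then have "0 < d (fst p) z"
        using M.nonneg[of "fst p" z] by linarith
      with \<rho>[OF n] show ?thesis by (simp add: obs_Y0_def u_def)
    qed (use \<rho>[OF n] in \<open>simp add: obs_Y0_def\<close>)
    then have "{p \<in> space (random_orbit_measure X \<epsilon> \<mu>). obs_Y0 d z p > ereal (u n)}
        = {p \<in> space (random_orbit_measure X \<epsilon> \<mu>). fst p \<in> {x \<in> X. d x z < \<rho> n}}"
      by (auto simp: random_orbit_measure_def space_pair_measure space_mu)
    then have "measure (random_orbit_measure X \<epsilon> \<mu>)
        {p \<in> space (random_orbit_measure X \<epsilon> \<mu>). obs_Y0 d z p > ereal (u n)} = \<tau> / real n"
      using measure_random_orbit_initial_event[OF noise prob ball] cdf_ball \<rho>[OF n] by simp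
    with n \<open>0 < \<tau>\<close> show ?thesis by simp
  qed
  moreover have "eventually (\<lambda>n. \<tau> < real n) sequentially"
    using filterlim_real_sequentially by (simp add: filterlim_at_top_dense)
  ultimately show ?thesis
    by (intro exI[of _ u] tendsto_eventually) (auto elim: eventually_mono)
qed

end
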